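(* There is no dense orbit in the big subshift $(\Sigma,\sigma)$: no $\omega\in\Sigma$ has $\{\sigma^n\omega:n\in\mathbb Z\}$ dense in $\Sigma$.
   Context: The Pascal graph has vertex set $\mathscr V=\{(x,y):x,y\in\mathbb Z_{\ge0}\}$ and, for each $(x,y)\in\mathscr V$, one directed edge from $(x,y)$ to $(x+1,y)$ and one to $(x,y+1)$. The root is $(0,0)$. An ordering is a function $\xi:\mathscr V\to\{0,1\}$: for $x,y\ge1$ the edge from $(x-1,y)$ to $(x,y)$ is less than the edge from $(x,y-1)$ to $(x,y)$ if and only if $\xi(x,y)=1$ (the values of $\xi$ at vertices with $x=0$ or $y=0$ play no role; the unique edge entering such a non-root vertex is both minimal and maximal). $X$ is the set of infinite directed paths starting at the root. Distinct paths $\gamma,\eta$ that eventually coincide are compared by $\gamma<\eta$ iff $\gamma_n<\eta_n$, where $n$ is the largest index with $\gamma_n\ne\eta_n$. For a path $\gamma$ not consisting entirely of maximal edges, $T_\xi\gamma$ is the smallest path larger than $\gamma$; $T_\xi^{-1}$ is defined on paths not consisting entirely of minimal edges. The $1$-coding of $\gamma\in X$ is the (possibly one-sided or finite) sequence over $\{a,b\}$ whose $n$-th entry, whenever $T_\xi^n\gamma$ is defined ($n\in\mathbb Z$), is $a$ if the first edge of $T_\xi^n\gamma$ goes from $(0,0)$ to $(1,0)$ and $b$ if it goes to $(0,1)$. For an ordering $\xi$, $\Sigma_\xi\subset\{a,b\}^{\mathbb Z}$ is the set of all two-sided sequences each of whose finite subblocks can be found in the $1$-coding (for $\xi$) of some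 $\gamma\in X$. $\mathscr L(\Omega)$ denotes the set of finite blocks seen in sequences of a subshift $\Omega$. The big subshift $(\Sigma,\sigma)$ is the subshift of $\{a,b\}^{\mathbb Z}$ with $\mathscr L(\Sigma)=\bigcup_\xi\mathscr L(\Sigma_\xi)$, the union over all orderings $\xi$ (equivalently, $\Sigma$ is the closure of $\bigcup_\xi\Sigma_\xi$); $\sigma$ is the shift. *)

theory Defs
  imports "HOL-Analysis.Analysis"
begin

section \<open>The Pascal graph and its orderings\<close>

type_synonym vertex = "nat \<times> nat"

text \<open>The graph has no multiple edges, so an edge is the pair of its source and its target.\<close>
type_synonym edge = "vertex \<times> vertex"

type_synonym path = "nat \<Rightarrow> edge"

text \<open>\<open>True\<close> stands for the value 1 and \<open>False\<close> for the value 0.\<close>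
type_synonym ordering = "vertex \<Rightarrow> bool"

definition pascal_edges :: "edge set" where
  "pascal_edges = {e. \<exists>x y. e = ((x, y), (x + 1, y)) \<or> e = ((x, y), (x, y + 1))}"

definition pascal_paths :: "path set" where
  "pascal_paths = {\<gamma>. fst (\<gamma> 0) = (0, 0) \<and> (\<forall>n. \<gamma> n \<in> pascal_edges)
           \<and> (\<forall>n. fst (\<gamma> (Suc n)) = snd (\<gamma> n))}"

definition edge_less :: "ordering \<Rightarrow> edge \<Rightarrow> edge \<Rightarrow> bool" where
  "edge_less \<xi> e f \<longleftrightarrow> (\<exists>x\<ge>1. \<exists>y\<ge>1.
     if \<xi> (x, y) then e = ((x - 1, y), (x, y)) \<and> f = ((x, y - 1), (x, y))
     else e = ((x, y - 1), (x, y)) \<and> f = ((x - 1, y), (x, y)))"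

definition maximal_edge :: "ordering \<Rightarrow> edge \<Rightarrow> bool" where
  "maximal_edge \<xi> e \<longleftrightarrow> e \<in> pascal_edges \<and> \<not> (\<exists>f. edge_less \<xi> e f)"

definition minimal_edge :: "ordering \<Rightarrow> edge \<Rightarrow> bool" where
  "minimal_edge \<xi> e \<longleftrightarrow> e \<in> pascal_edges \<and> \<not> (\<exists>f. edge_less \<xi> f e)"

definition path_less :: "ordering \<Rightarrow> path \<Rightarrow> path \<Rightarrow> bool" where
  "path_less \<xi> \<gamma> \<eta> \<longleftrightarrow> (\<exists>n. edge_less \<xi> (\<gamma> n) (\<eta> n) \<and> (\<forall>m>n. \<gamma> m = \<eta> m))"

definition smallest_above :: "ordering \<Rightarrow> path \<Rightarrow> path \<Rightarrow> bool" where
  "smallest_above \<xi> \<gamma> \<eta> \<longleftrightarrow> \<eta> \<in> pascal_paths \<and> path_less \<xi> \<gamma> \<eta>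
     \<and> (\<forall>\<zeta>\<in>pascal_paths. path_less \<xi> \<gamma> \<zeta> \<longrightarrow> \<eta> = \<zeta> \<or> path_less \<xi> \<eta> \<zeta>)"


section \<open>The adic transformation and the 1-coding\<close>

definition adic :: "ordering \<Rightarrow> path \<Rightarrow> path option" where
  "adic \<xi> \<gamma> = (if \<forall>n. maximal_edge \<xi> (\<gamma> n) then None
            else Some (THE \<eta>. smallest_above \<xi> \<gamma> \<eta>))"

definition adic_inv :: "ordering \<Rightarrow> path \<Rightarrow> path option" where
  "adic_inv \<xi> \<gamma> = (if \<forall>n. minimal_edge \<xi> (\<gamma> n) then None
                else Some (THE \<eta>. \<eta> \<in> pascal_paths \<and> adic \<xi> \<eta> = Some \<gamma>))"

definition adic_pow :: "ordering \<Rightarrow> int \<Rightarrow> path \<Rightarrow> path option" where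
  "adic_pow \<xi> n \<gamma> =
     (if 0 \<le> n then ((\<lambda>p. Option.bind p (adic \<xi>)) ^^ nat n) (Some \<gamma>)
      else ((\<lambda>p. Option.bind p (adic_inv \<xi>)) ^^ nat (- n)) (Some \<gamma>))"

datatype letter = a | b

hide_const (open) a b

definition coding :: "ordering \<Rightarrow> path \<Rightarrow> int \<Rightarrow> letter option" where
  "coding \<xi> \<gamma> n =
     map_option (\<lambda>\<eta>. if \<eta> 0 = ((0, 0), (1, 0)) then letter.a else letter.b) (adic_pow \<xi> n \<gamma>)"


section \<open>Subshifts\<close>

type_synonym bisequence = "int \<Rightarrow> letter"

definition full_shift :: "bisequence topology" where
  "full_shift = product_topology (\<lambda>_. discrete_topology UNIV) UNIV"

definition shift :: "bisequence \<Rightarrow> bisequence" where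
  "shift \<omega> = (\<lambda>i. \<omega> (i + 1))"

text \<open>The power \<open>n\<close> of the shift, for every integer \<open>n\<close>; see \<open>shift_pow_nat\<close> and
  \<open>shift_pow_minus\<close> below.\<close>
definition shift_pow :: "int \<Rightarrow> bisequence \<Rightarrow> bisequence" where
  "shift_pow n \<omega> = (\<lambda>i. \<omega> (i + n))"

definition orbit :: "bisequence \<Rightarrow> bisequence set" where
  "orbit \<omega> = {shift_pow n \<omega> | n. True}"

definition subshift :: "bisequence set \<Rightarrow> bool" where
  "subshift \<Omega> \<longleftrightarrow> closedin full_shift \<Omega> \<and> shift ` \<Omega> = \<Omega>"

definition block :: "bisequence \<Rightarrow> int \<Rightarrow> nat \<Rightarrow> letter list" where
  "block \<omega> k n = map (\<lambda>i. \<omega> (k + int i)) [0..<n]"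

definition language :: "bisequence set \<Rightarrow> letter list set" where
  "language \<Omega> = {block \<omega> k n | \<omega> k n. \<omega> \<in> \<Omega>}"

definition found_in_coding :: "letter list \<Rightarrow> (int \<Rightarrow> letter option) \<Rightarrow> bool" where
  "found_in_coding w c \<longleftrightarrow> (\<exists>k. \<forall>i<length w. c (k + int i) = Some (w ! i))"

definition Sigma_ord :: "ordering \<Rightarrow> bisequence set" where
  "Sigma_ord \<xi> = {\<omega>. \<forall>k n. \<exists>\<gamma>\<in>pascal_paths. found_in_coding (block \<omega> k n) (coding \<xi> \<gamma>)}"

text \<open>The big subshift is the subshift with language \<open>\<Union>\<xi>. language (Sigma_ord \<xi>)\<close>; a subshift is
  the set of the sequences all of whose blocks are in its language. The lemmas
  \<open>big_subshift_unique\<close> and \<open>big_subshift_closure\<close> below confirm that this is the only subshift with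
  that language, and that it is the closure of \<open>\<Union>\<xi>. Sigma_ord \<xi>\<close>.\<close>
definition big_subshift :: "bisequence set" where
  "big_subshift = {\<omega>. \<forall>k n. block \<omega> k n \<in> (\<Union>\<xi>. language (Sigma_ord \<xi>))}"

definition dense_in :: "bisequence set \<Rightarrow> bisequence set \<Rightarrow> bool" where
  "dense_in D \<Omega> \<longleftrightarrow> D \<subseteq> \<Omega> \<and> subtopology full_shift \<Omega> closure_of D = \<Omega>"


section \<open>Consistency of the definitions\<close>

subsection \<open>The definite descriptions in \<open>adic\<close> and \<open>adic_inv\<close>\<close>

lemma edge_less_asym: "edge_less \<xi> e f \<Longrightarrow> \<not> edge_less \<xi> f g"
  by (auto simp: edge_less_def split: if_splits)

lemma edge_less_irrefl: "\<not> edge_less \<xi> e e"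
  using edge_less_asym by blast

lemma edge_less_total:
  assumes "e \<in> pascal_edges" "f \<in> pascal_edges" "snd e = snd f" "e \<noteq> f"
  shows "edge_less \<xi> e f \<or> edge_less \<xi> f e"
proof -
  obtain x y where xy: "snd e = (x, y)" by (cases "snd e")
  have "x \<ge> 1" "y \<ge> 1" "e = ((x - 1, y), (x, y)) \<and> f = ((x, y - 1), (x, y))
      \<or> f = ((x - 1, y), (x, y)) \<and> e = ((x, y - 1), (x, y))"
    using assms xy by (auto simp: pascal_edges_def)
  then have "if \<xi> (x, y) then edge_less \<xi> ((x - 1, y), (x, y)) ((x, y - 1), (x, y))
      else edge_less \<xi> ((x, y - 1), (x, y)) ((x - 1, y), (x, y))"
    unfolding edge_less_def by auto
  then show ?thesis
    using \<open>e = _ \<and> f = _ \<or> f = _ \<and> e = _\<close> by (auto split: if_splits)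
qed

lemma edge_less_edges:
  assumes "edge_less \<xi> e f"
  shows "e \<in> pascal_edges" "f \<in> pascal_edges" "snd e = snd f"
proof -
  obtain x y where xy: "x \<ge> 1" "y \<ge> 1" "e = ((x - 1, y), (x, y)) \<and> f = ((x, y - 1), (x, y))
      \<or> f = ((x - 1, y), (x, y)) \<and> e = ((x, y - 1), (x, y))"
    using assms unfolding edge_less_def by (auto split: if_splits)
  have "((x - 1, y), (x, y)) \<in> pascal_edges" "((x, y - 1), (x, y)) \<in> pascal_edges"
    using xy(1,2) unfolding pascal_edges_def by (cases x; cases y; force)+
  then show "e \<in> pascal_edges" "f \<in> pascal_edges" "snd e = snd f" using xy(3) by auto
qed

lemma edge_less_opposite: "edge_less (\<lambda>v. \<not> \<xi> v) e f \<longleftrightarrow> edge_less \<xi> f e"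
  unfolding edge_less_def by (auto split: if_splits)

lemma path_less_opposite: "path_less (\<lambda>v. \<not> \<xi> v) \<gamma> \<eta> \<longleftrightarrow> path_less \<xi> \<eta> \<gamma>"
  unfolding path_less_def edge_less_opposite by metis

lemma path_less_irrefl: "\<not> path_less \<xi> \<gamma> \<gamma>"
  by (simp add: path_less_def edge_less_irrefl)

lemma path_less_trans:
  assumes "path_less \<xi> \<gamma> \<eta>" "path_less \<xi> \<eta> \<zeta>"
  shows "path_less \<xi> \<gamma> \<zeta>"
proof -
  obtain n m where n: "edge_less \<xi> (\<gamma> n) (\<eta> n)" "\<forall>i>n. \<gamma> i = \<eta> i"
    and m: "edge_less \<xi> (\<eta> m) (\<zeta> m)" "\<forall>i>m. \<eta> i = \<zeta> i"
    using assms unfolding path_less_def by blast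
  have "n \<noteq> m" using n(1) m(1) edge_less_asym by blast
  then have "edge_less \<xi> (\<gamma> (max n m)) (\<zeta> (max n m))"
    using n m by (cases "n < m") (auto simp: max_def)
  moreover have "\<forall>i>max n m. \<gamma> i = \<zeta> i" using n(2) m(2) by simp
  ultimately show ?thesis unfolding path_less_def by blast
qed

lemma path_less_total:
  assumes "\<gamma> \<in> pascal_paths" "\<eta> \<in> pascal_paths" "\<forall>m>N. \<gamma> m = \<eta> m" "\<gamma> \<noteq> \<eta>"
  shows "path_less \<xi> \<gamma> \<eta> \<or> path_less \<xi> \<eta> \<gamma>"
proof -
  let ?D = "{n. \<gamma> n \<noteq> \<eta> n}"
  have D: "finite ?D" "?D \<noteq> {}"
  proof -
    have "?D \<subseteq> {..N}" using assms(3) by (metis (mono_tags) atMost_iff mem_Collect_eq not_le subsetI)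
    then show "finite ?D" by (rule finite_subset) simp
    show "?D \<noteq> {}" using assms(4) by (auto simp: fun_eq_iff)
  qed
  define n where "n = Max ?D"
  have "\<gamma> n \<noteq> \<eta> n" using Max_in[OF D] unfolding n_def by blast
  moreover have "\<forall>m>n. \<gamma> m = \<eta> m"
    using Max_ge[OF D(1)] unfolding n_def by (metis (mono_tags) mem_Collect_eq not_le)
  ultimately have n: "\<gamma> n \<noteq> \<eta> n" "\<forall>m>n. \<gamma> m = \<eta> m" by blast+
  have "fst (\<gamma> (Suc n)) = snd (\<gamma> n)" "fst (\<eta> (Suc n)) = snd (\<eta> n)"
      "\<gamma> n \<in> pascal_edges" "\<eta> n \<in> pascal_edges"
    using assms(1,2) by (auto simp: pascal_paths_def)
  then have "edge_less \<xi> (\<gamma> n) (\<eta> n) \<or> edge_less \<xi> (\<eta> n) (\<gamma> n)"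
    using n by (intro edge_less_total) auto
  then show ?thesis using n(2) unfolding path_less_def by metis
qed

lemma pascal_path_level: "\<gamma> \<in> pascal_paths \<Longrightarrow> fst (fst (\<gamma> n)) + snd (fst (\<gamma> n)) = n"
proof (induction n)
  case (Suc n)
  then have "fst (\<gamma> (Suc n)) = snd (\<gamma> n)" "\<gamma> n \<in> pascal_edges"
      "fst (fst (\<gamma> n)) + snd (fst (\<gamma> n)) = n"
    by (auto simp: pascal_paths_def)
  then show ?case by (auto simp: pascal_edges_def)
qed (simp add: pascal_paths_def)

lemma finite_paths_agreeing_after:
  "finite {\<zeta> \<in> pascal_paths. \<forall>m>n. \<zeta> m = \<gamma> m}" (is "finite ?S")
proof -
  let ?F = "({..Suc n} \<times> {..Suc n}) \<times> ({..Suc n} \<times> {..Suc n})"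
  have "\<zeta> \<in> (\<lambda>g m. if m \<le> n then g m else \<gamma> m) ` (PiE {..n} (\<lambda>_. ?F))" if z: "\<zeta> \<in> ?S" for \<zeta>
  proof (rule image_eqI[where x = "restrict \<zeta> {..n}"])
    show "\<zeta> = (\<lambda>m. if m \<le> n then restrict \<zeta> {..n} m else \<gamma> m)"
      using z by (auto simp: fun_eq_iff)
    have "\<zeta> m \<in> ?F" if "m \<le> n" for m
    proof -
      have "\<zeta> m \<in> pascal_edges" using z by (simp add: pascal_paths_def)
      then show ?thesis using pascal_path_level[of \<zeta> m] z \<open>m \<le> n\<close> by (auto simp: pascal_edges_def)
    qed
    then show "restrict \<zeta> {..n} \<in> PiE {..n} (\<lambda>_. ?F)" by auto
  qed
  then have "?S \<subseteq> (\<lambda>g m. if m \<le> n then g m else \<gamma> m) ` (PiE {..n} (\<lambda>_. ?F))" by blast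
  moreover have "finite (PiE {..n} (\<lambda>_. ?F))" by (intro finite_PiE) auto
  ultimately show ?thesis by (meson finite_imageI finite_subset)
qed

lemma ex_path_through:
  assumes g: "\<gamma> \<in> pascal_paths" and f: "f \<in> pascal_edges" "snd f = snd (\<gamma> n)"
  obtains \<zeta> where "\<zeta> \<in> pascal_paths" "\<zeta> n = f" "\<forall>m>n. \<zeta> m = \<gamma> m"
proof -
  obtain p q where pq: "fst f = (p, q)" by (cases "fst f")
  have lev: "fst (snd e) + snd (snd e) = Suc (fst (fst e) + snd (fst e))" if "e \<in> pascal_edges" for e
    using that by (auto simp: pascal_edges_def)
  have "\<gamma> n \<in> pascal_edges" using g by (simp add: pascal_paths_def)
  then have n: "p + q = n" using lev[of "\<gamma> n"] lev[OF f(1)] f(2) pq pascal_path_level[OF g, of n] by simp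
  define v where "v i = (min i p, i - p)" for i :: nat
  define \<zeta> where "\<zeta> i = (if i < n then (v i, v (Suc i)) else if i = n then f else \<gamma> i)" for i
  have v: "(v i, v (Suc i)) \<in> pascal_edges" for i
  proof (cases "i < p")
    case True
    then have "v i = (i, 0)" "v (Suc i) = (i + 1, 0)" by (auto simp: v_def)
    then show ?thesis by (auto simp: pascal_edges_def)
  next
    case False
    then have "v i = (p, i - p)" "v (Suc i) = (p, (i - p) + 1)" by (auto simp: v_def)
    then show ?thesis unfolding pascal_edges_def by blast
  qed
  have vn: "v n = fst f" using n pq by (auto simp: v_def)
  have "\<zeta> \<in> pascal_paths"
    unfolding pascal_paths_def
  proof (intro CollectI conjI allI)
    show "fst (\<zeta> 0) = (0, 0)" using vn by (auto simp: \<zeta>_def v_def)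
    show "\<zeta> i \<in> pascal_edges" for i using v f g by (auto simp: \<zeta>_def pascal_paths_def)
    show "fst (\<zeta> (Suc i)) = snd (\<zeta> i)" for i
    proof (cases "Suc i = n")
      case True
      then show ?thesis using vn by (auto simp: \<zeta>_def)
    next
      case False
      then show ?thesis using f g by (auto simp: \<zeta>_def pascal_paths_def)
    qed
  qed
  then show ?thesis by (rule that) (auto simp: \<zeta>_def)
qed

theorem ex1_smallest_above:
  assumes g: "\<gamma> \<in> pascal_paths" and "\<not> (\<forall>n. maximal_edge \<xi> (\<gamma> n))"
  shows "\<exists>!\<eta>. smallest_above \<xi> \<gamma> \<eta>"
proof (rule ex_ex1I)
  have ge: "\<gamma> n \<in> pascal_edges" for n using g by (simp add: pascal_paths_def)
  then obtain n f where f: "edge_less \<xi> (\<gamma> n) f"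
    using assms(2) unfolding maximal_edge_def by blast
  have "f \<in> pascal_edges" "snd f = snd (\<gamma> n)"
    using edge_less_edges[OF f] by simp_all
  then obtain \<zeta>0 where z0: "\<zeta>0 \<in> pascal_paths" "\<zeta>0 n = f" "\<forall>m>n. \<zeta>0 m = \<gamma> m"
    using ex_path_through[OF g] by blast
  define S where "S = {\<zeta> \<in> pascal_paths. (\<forall>m>n. \<zeta> m = \<gamma> m) \<and> path_less \<xi> \<gamma> \<zeta>}"
  have "finite S" unfolding S_def by (rule finite_subset[OF _ finite_paths_agreeing_after]) auto
  moreover have "path_less \<xi> \<gamma> \<zeta>0"
    unfolding path_less_def by (rule exI[of _ n]) (use z0 f in auto)
  then have "S \<noteq> {}" using z0 by (auto simp: S_def)
  moreover have "asymp_on S (path_less \<xi>)" "transp_on S (path_less \<xi>)"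
    using path_less_trans path_less_irrefl by (auto intro!: asymp_onI transp_onI) blast+
  ultimately obtain \<eta> where eta: "\<eta> \<in> S" "\<forall>\<zeta>\<in>S. \<zeta> \<noteq> \<eta> \<longrightarrow> \<not> path_less \<xi> \<zeta> \<eta>"
    using Finite_Set.bex_min_element[of S "path_less \<xi>"] by blast
  have "\<eta> = \<zeta> \<or> path_less \<xi> \<eta> \<zeta>" if z: "\<zeta> \<in> pascal_paths" "path_less \<xi> \<gamma> \<zeta>" for \<zeta>
  proof -
    obtain m where m: "edge_less \<xi> (\<gamma> m) (\<zeta> m)" "\<forall>i>m. \<gamma> i = \<zeta> i"
      using z(2) unfolding path_less_def by blast
    show ?thesis
    proof (cases "m > n")
      case True
      then have "edge_less \<xi> (\<eta> m) (\<zeta> m)" "\<forall>i>m. \<eta> i = \<zeta> i" using m eta(1) by (auto simp: S_def)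
      then show ?thesis unfolding path_less_def by blast
    next
      case False
      then have "\<zeta> \<in> S" using z m by (auto simp: S_def)
      then show ?thesis using eta path_less_total[of \<eta> \<zeta> n \<xi>] by (auto simp: S_def)
    qed
  qed
  then show "\<exists>\<eta>. smallest_above \<xi> \<gamma> \<eta>"
    using eta(1) unfolding smallest_above_def S_def by blast
next
  show "\<eta> = \<eta>'" if "smallest_above \<xi> \<gamma> \<eta>" "smallest_above \<xi> \<gamma> \<eta>'" for \<eta> \<eta>'
    using that path_less_trans path_less_irrefl unfolding smallest_above_def by blast
qed

lemma adic_eq_Some_iff:
  assumes "\<gamma> \<in> pascal_paths"
  shows "adic \<xi> \<gamma> = Some \<eta> \<longleftrightarrow> smallest_above \<xi> \<gamma> \<eta>"
proof (cases "\<forall>n. maximal_edge \<xi> (\<gamma> n)")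
  case True
  then have "\<not> smallest_above \<xi> \<gamma> \<eta>"
    unfolding smallest_above_def path_less_def maximal_edge_def by blast
  then show ?thesis using True by (simp add: adic_def)
next
  case False
  note ex1 = ex1_smallest_above[OF assms False]
  have "(THE \<eta>. smallest_above \<xi> \<gamma> \<eta>) = \<eta> \<longleftrightarrow> smallest_above \<xi> \<gamma> \<eta>"
    using theI'[OF ex1] the1_equality[OF ex1] by blast
  moreover have "adic \<xi> \<gamma> = Some (THE \<eta>. smallest_above \<xi> \<gamma> \<eta>)" using False by (simp only: adic_def if_False)
  ultimately show ?thesis by simp
qed

theorem ex1_adic_preimage:
  assumes g: "\<gamma> \<in> pascal_paths" and "\<not> (\<forall>n. minimal_edge \<xi> (\<gamma> n))"
  shows "\<exists>!\<eta>. \<eta> \<in> pascal_paths \<and> adic \<xi> \<eta> = Some \<gamma>"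
proof -
  have "\<not> (\<forall>n. maximal_edge (\<lambda>v. \<not> \<xi> v) (\<gamma> n))"
    using assms(2) by (simp add: maximal_edge_def minimal_edge_def edge_less_opposite)
  then obtain \<eta> where "smallest_above (\<lambda>v. \<not> \<xi> v) \<gamma> \<eta>"
    using ex1_smallest_above[OF g] by blast
  then have eta: "\<eta> \<in> pascal_paths" "path_less \<xi> \<eta> \<gamma>"
      "\<And>\<zeta>. \<zeta> \<in> pascal_paths \<Longrightarrow> path_less \<xi> \<zeta> \<gamma> \<Longrightarrow> \<eta> = \<zeta> \<or> path_less \<xi> \<zeta> \<eta>"
    by (auto simp: smallest_above_def path_less_opposite)
  have tail: "\<alpha> = \<beta> \<or> path_less \<xi> \<alpha> \<beta> \<or> path_less \<xi> \<beta> \<alpha>"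
    if "\<alpha> \<in> pascal_paths" "\<beta> \<in> pascal_paths" "\<forall>m>i. \<alpha> m = \<delta> m" "\<forall>m>j. \<beta> m = \<delta> m" for \<alpha> \<beta> \<delta> i j
    using path_less_total[of \<alpha> \<beta> "max i j" \<xi>] that by auto
  have "\<gamma> = \<zeta> \<or> path_less \<xi> \<gamma> \<zeta>" if z: "\<zeta> \<in> pascal_paths" "path_less \<xi> \<eta> \<zeta>" for \<zeta>
  proof -
    obtain i j where "\<forall>m>i. \<gamma> m = \<eta> m" "\<forall>m>j. \<zeta> m = \<eta> m"
      using eta(2) z(2) unfolding path_less_def by metis
    moreover have "\<not> path_less \<xi> \<zeta> \<gamma>"
      using eta(3)[OF z(1)] z(2) path_less_trans path_less_irrefl by blast
    ultimately show ?thesis using tail[OF g z(1)] by blast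
  qed
  then have ex: "adic \<xi> \<eta> = Some \<gamma>"
    using eta g by (simp add: adic_eq_Some_iff smallest_above_def)
  have "\<eta>' = \<eta>" if e: "\<eta>' \<in> pascal_paths" "adic \<xi> \<eta>' = Some \<gamma>" for \<eta>'
  proof -
    have s: "path_less \<xi> \<eta>' \<gamma>" "\<And>\<zeta>. \<zeta> \<in> pascal_paths \<Longrightarrow> path_less \<xi> \<eta>' \<zeta> \<Longrightarrow> \<gamma> = \<zeta> \<or> path_less \<xi> \<gamma> \<zeta>"
      using e by (auto simp: adic_eq_Some_iff smallest_above_def)
    have "\<not> path_less \<xi> \<eta>' \<eta>"
      using s(2)[OF eta(1)] eta(2) path_less_trans path_less_irrefl by blast
    then show ?thesis using eta(3)[OF e(1) s(1)] by blast
  qed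
  then show ?thesis using eta(1) ex by blast
qed


subsection \<open>The big subshift\<close>

lemma shift_pow_nat: "shift_pow (int n) \<omega> = (shift ^^ n) \<omega>"
  by (induction n arbitrary: \<omega>) (auto simp: shift_pow_def shift_def algebra_simps fun_eq_iff)

lemma shift_pow_minus: "shift_pow (- n) (shift_pow n \<omega>) = \<omega>"
  by (simp add: shift_pow_def)

lemma topspace_full_shift [simp]: "topspace full_shift = UNIV"
  by (simp add: full_shift_def PiE_UNIV_domain)

lemma length_block [simp]: "length (block \<omega> k n) = n"
  by (simp add: block_def)

lemma block_eq_iff: "block \<omega> k n = block \<eta> k n \<longleftrightarrow> (\<forall>i\<in>{k..<k + int n}. \<omega> i = \<eta> i)"
proof
  assume L: "block \<omega> k n = block \<eta> k n"
  show "\<forall>i\<in>{k..<k + int n}. \<omega> i = \<eta> i"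
  proof
    fix i assume "i \<in> {k..<k + int n}"
    then have "nat (i - k) < n" "k + int (nat (i - k)) = i" by auto
    then show "\<omega> i = \<eta> i"
      using arg_cong[OF L, of "\<lambda>w. w ! nat (i - k)"] by (simp add: block_def)
  qed
qed (auto simp: block_def)

lemma openin_cylinder: "openin full_shift {\<eta>. block \<eta> k n = block \<omega> k n}"
proof -
  have "{\<eta>. block \<eta> k n = block \<omega> k n}
        = (\<Pi>\<^sub>E i\<in>UNIV. if i \<in> {k..<k + int n} then {\<omega> i} else UNIV)"
    by (auto simp: block_eq_iff PiE_UNIV_domain split: if_splits)
  moreover have "openin full_shift (\<Pi>\<^sub>E i\<in>UNIV. if i \<in> {k..<k + int n} then {\<omega> i} else UNIV)"
    unfolding full_shift_def
  proof (rule product_topology_basis)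
    have "{i. (if i \<in> {k..<k + int n} then {\<omega> i} else UNIV) \<noteq> topspace (discrete_topology UNIV)}
          \<subseteq> {k..<k + int n}"
      by auto
    then show "finite {i. (if i \<in> {k..<k + int n} then {\<omega> i} else UNIV)
                 \<noteq> topspace (discrete_topology (UNIV :: letter set))}"
      by (rule finite_subset) simp
  qed auto
  ultimately show ?thesis by simp
qed

lemma cylinder_in_open:
  assumes "openin full_shift U" "\<omega> \<in> U"
  obtains k n where "{\<eta>. block \<eta> k n = block \<omega> k n} \<subseteq> U"
proof -
  have "\<exists>V. finite {i. V i \<noteq> (UNIV :: letter set)} \<and> \<omega> \<in> (\<Pi>\<^sub>E i\<in>UNIV. V i) \<and> (\<Pi>\<^sub>E i\<in>UNIV. V i) \<subseteq> U"
    using assms unfolding full_shift_def openin_product_topology_alt by simp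
  then obtain V where V: "finite {i. V i \<noteq> (UNIV :: letter set)}" "\<forall>i. \<omega> i \<in> V i" "(\<Pi>\<^sub>E i\<in>UNIV. V i) \<subseteq> U"
    by (auto simp: PiE_UNIV_domain)
  obtain m where m: "\<And>i. V i \<noteq> UNIV \<Longrightarrow> \<bar>i\<bar> \<le> m"
  proof
    show "\<bar>i\<bar> \<le> Max (abs ` {i. V i \<noteq> UNIV})" if "V i \<noteq> UNIV" for i
      by (rule Max_ge) (use V(1) that in auto)
  qed
  have "{\<eta>. block \<eta> (- m) (nat (2 * m + 1)) = block \<omega> (- m) (nat (2 * m + 1))} \<subseteq> U"
  proof safe
    fix \<eta> assume eq: "block \<eta> (- m) (nat (2 * m + 1)) = block \<omega> (- m) (nat (2 * m + 1))"
    have "\<eta> i \<in> V i" for i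
    proof (cases "V i = UNIV")
      case False
      have "i \<in> {- m..<- m + int (nat (2 * m + 1))}" using m[OF False] by auto
      then have "\<eta> i = \<omega> i" using eq unfolding block_eq_iff by blast
      then show ?thesis using V(2) by simp
    qed simp
    then show "\<eta> \<in> U" using V(3) by (auto simp: PiE_UNIV_domain)
  qed
  then show ?thesis by (rule that)
qed

lemma in_closure_iff: "\<omega> \<in> full_shift closure_of S \<longleftrightarrow> (\<forall>k n. \<exists>\<eta>\<in>S. block \<eta> k n = block \<omega> k n)"
proof
  assume cl: "\<omega> \<in> full_shift closure_of S"
  show "\<forall>k n. \<exists>\<eta>\<in>S. block \<eta> k n = block \<omega> k n"
  proof (intro allI)
    fix k n
    let ?C = "{\<eta>. block \<eta> k n = block \<omega> k n}"
    have "openin full_shift ?C" "\<omega> \<in> ?C" using openin_cylinder by auto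
    then obtain \<eta> where "\<eta> \<in> S" "\<eta> \<in> ?C" using cl unfolding in_closure_of by meson
    then show "\<exists>\<eta>\<in>S. block \<eta> k n = block \<omega> k n" by blast
  qed
next
  assume R: "\<forall>k n. \<exists>\<eta>\<in>S. block \<eta> k n = block \<omega> k n"
  show "\<omega> \<in> full_shift closure_of S"
    unfolding in_closure_of
  proof (intro conjI allI impI)
    fix U assume "\<omega> \<in> U \<and> openin full_shift U"
    then obtain k n where "{\<eta>. block \<eta> k n = block \<omega> k n} \<subseteq> U"
      using cylinder_in_open by blast
    then show "\<exists>\<eta>. \<eta> \<in> S \<and> \<eta> \<in> U" using R by blast
  qed simp
qed

lemma block_shift_pow: "block (shift_pow m \<omega>) k n = block \<omega> (k + m) n"
  by (simp add: block_def shift_pow_def algebra_simps)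

lemma shift_pow_subshift:
  assumes "subshift \<Omega>" "\<omega> \<in> \<Omega>"
  shows "shift_pow n \<omega> \<in> \<Omega>"
proof -
  have inv: "shift_pow (- 1) \<eta> \<in> \<Omega>" and fwd: "shift_pow 1 \<eta> \<in> \<Omega>" if "\<eta> \<in> \<Omega>" for \<eta>
  proof -
    obtain \<zeta> where "\<zeta> \<in> \<Omega>" "\<eta> = shift \<zeta>" using assms(1) \<open>\<eta> \<in> \<Omega>\<close> unfolding subshift_def by blast
    then show "shift_pow (- 1) \<eta> \<in> \<Omega>" by (simp add: shift_pow_def shift_def)
    have "shift \<eta> \<in> \<Omega>" using assms(1) \<open>\<eta> \<in> \<Omega>\<close> unfolding subshift_def by blast
    then show "shift_pow 1 \<eta> \<in> \<Omega>" by (simp add: shift_pow_def shift_def)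
  qed
  have add: "shift_pow i (shift_pow j \<eta>) = shift_pow (j + i) \<eta>" for i j \<eta>
    by (simp add: shift_pow_def algebra_simps)
  show ?thesis
  proof (induction n rule: int_induct[where k = 0])
    case base
    then show ?case using assms(2) by (simp add: shift_pow_def)
  next
    case (step1 i)
    then show ?case using fwd[OF step1.IH] add by simp
  next
    case (step2 i)
    then show ?case using inv[OF step2.IH] add by simp
  qed
qed

lemma subshift_eq_language:
  assumes "subshift \<Omega>"
  shows "\<Omega> = {\<omega>. \<forall>k n. block \<omega> k n \<in> language \<Omega>}"
proof
  show "\<Omega> \<subseteq> {\<omega>. \<forall>k n. block \<omega> k n \<in> language \<Omega>}" by (auto simp: language_def)
  show "{\<omega>. \<forall>k n. block \<omega> k n \<in> language \<Omega>} \<subseteq> \<Omega>"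
  proof safe
    fix \<omega> assume L: "\<forall>k n. block \<omega> k n \<in> language \<Omega>"
    have "\<exists>\<eta>\<in>\<Omega>. block \<eta> k n = block \<omega> k n" for k n
    proof -
      obtain \<zeta> j m where z: "\<zeta> \<in> \<Omega>" "block \<omega> k n = block \<zeta> j m"
        using L unfolding language_def by blast
      have "m = n" by (metis z(2) length_block)
      then have "block (shift_pow (j - k) \<zeta>) k n = block \<omega> k n"
        using z by (simp add: block_shift_pow)
      then show ?thesis using shift_pow_subshift[OF assms z(1)] by blast
    qed
    then have "\<omega> \<in> full_shift closure_of \<Omega>" by (simp add: in_closure_iff)
    then show "\<omega> \<in> \<Omega>" using assms unfolding subshift_def by (simp add: closure_of_closedin)
  qed
qed

lemma Sigma_ord_shift_pow: "\<omega> \<in> Sigma_ord \<xi> \<Longrightarrow> shift_pow n \<omega> \<in> Sigma_ord \<xi>"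
  by (simp add: Sigma_ord_def block_shift_pow)

lemma big_subshift_shift_pow: "\<omega> \<in> big_subshift \<Longrightarrow> shift_pow n \<omega> \<in> big_subshift"
  by (simp add: big_subshift_def block_shift_pow)

theorem big_subshift_closure: "big_subshift = full_shift closure_of (\<Union>\<xi>. Sigma_ord \<xi>)"
proof safe
  fix \<omega> assume w: "\<omega> \<in> big_subshift"
  have "\<exists>\<eta>\<in>(\<Union>\<xi>. Sigma_ord \<xi>). block \<eta> k n = block \<omega> k n" for k n
  proof -
    obtain \<xi> \<zeta> j m where z: "\<zeta> \<in> Sigma_ord \<xi>" "block \<omega> k n = block \<zeta> j m"
      using w unfolding big_subshift_def language_def by blast
    have "m = n" by (metis z(2) length_block)
    then have "block (shift_pow (j - k) \<zeta>) k n = block \<omega> k n"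
      using z by (simp add: block_shift_pow)
    then show ?thesis using Sigma_ord_shift_pow[OF z(1)] by blast
  qed
  then show "\<omega> \<in> full_shift closure_of (\<Union>\<xi>. Sigma_ord \<xi>)" by (simp add: in_closure_iff)
next
  fix \<omega> assume w: "\<omega> \<in> full_shift closure_of (\<Union>\<xi>. Sigma_ord \<xi>)"
  show "\<omega> \<in> big_subshift"
    unfolding big_subshift_def
  proof safe
    fix k n
    obtain \<eta> \<xi> where "\<eta> \<in> Sigma_ord \<xi>" "block \<eta> k n = block \<omega> k n"
      using w unfolding in_closure_iff by blast
    then show "block \<omega> k n \<in> (\<Union>\<xi>. language (Sigma_ord \<xi>))"
      unfolding language_def by (auto intro!: exI[of _ \<xi>] exI[of _ \<eta>] exI[of _ k] exI[of _ n])
  qed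
qed

theorem big_subshift_unique:
  "subshift \<Omega> \<and> language \<Omega> = (\<Union>\<xi>. language (Sigma_ord \<xi>)) \<longleftrightarrow> \<Omega> = big_subshift"
proof
  assume "subshift \<Omega> \<and> language \<Omega> = (\<Union>\<xi>. language (Sigma_ord \<xi>))"
  then show "\<Omega> = big_subshift"
    using subshift_eq_language[of \<Omega>] unfolding big_subshift_def by simp
next
  have sub: "Sigma_ord \<xi> \<subseteq> big_subshift" for \<xi>
    unfolding big_subshift_def language_def by blast
  have "shift ` big_subshift = big_subshift"
  proof
    have sh: "shift \<omega> = shift_pow 1 \<omega>" for \<omega> by (simp add: shift_def shift_pow_def)
    show "shift ` big_subshift \<subseteq> big_subshift" using big_subshift_shift_pow by (auto simp: sh)
    show "big_subshift \<subseteq> shift ` big_subshift"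
    proof
      fix \<omega> assume w: "\<omega> \<in> big_subshift"
      have "\<omega> = shift (shift_pow (- 1) \<omega>)" by (simp add: shift_def shift_pow_def)
      then show "\<omega> \<in> shift ` big_subshift" using big_subshift_shift_pow[OF w] by blast
    qed
  qed
  moreover have "closedin full_shift big_subshift"
    unfolding big_subshift_closure by (rule closedin_closure_of)
  ultimately have "subshift big_subshift" unfolding subshift_def by blast
  moreover have "language big_subshift = (\<Union>\<xi>. language (Sigma_ord \<xi>))"
  proof
    show "language big_subshift \<subseteq> (\<Union>\<xi>. language (Sigma_ord \<xi>))"
    proof
      fix w assume "w \<in> language big_subshift"
      then obtain \<omega> k n where "\<omega> \<in> big_subshift" "w = block \<omega> k n" unfolding language_def by blast
      then show "w \<in> (\<Union>\<xi>. language (Sigma_ord \<xi>))" unfolding big_subshift_def by blast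
    qed
    show "(\<Union>\<xi>. language (Sigma_ord \<xi>)) \<subseteq> language big_subshift"
      using sub unfolding language_def by blast
  qed
  ultimately show "\<Omega> = big_subshift \<Longrightarrow>
      subshift \<Omega> \<and> language \<Omega> = (\<Union>\<xi>. language (Sigma_ord \<xi>))" by simp
qed

end

theory Submission
  imports Defs "HOL-Library.Sublist"
begin

text \<open>
  The proof compares complexities. For an ordering \<open>\<xi>\<close>, let \<open>word \<xi> x y\<close> be the coding of all finite
  paths to the vertex \<open>(x, y)\<close> in increasing order. A block occurs in a coding for \<open>\<xi>\<close> only if it is a
  factor of one of these words (\<open>found_in_coding_factor\<close>).

  A single ordering has few blocks. The word at a vertex is the concatenation of the words at its two
  predecessors, so a factor is either inherited from a predecessor or consists of a suffix of one
  word and a prefix of another. The prefixes of a given length are quadratically many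
  (\<open>prefix_word_cases\<close>), because long words next to an axis are very simple and the other long words
  repeat the prefix of a predecessor. Hence, for every ordering, at most \<open>9 * (L + 1) ^ 5\<close> blocks of
  length \<open>L\<close> are factors of its words (\<open>card_factors_word\<close>), a bound that is uniform in \<open>\<xi>\<close>.

  The big subshift has many blocks. Varying the ordering at \<open>n\<close> vertices of the row \<open>y = 2\<close> alone
  produces \<open>2 ^ n\<close> distinct words of the common length \<open>(n + 2) choose 2\<close> (\<open>word_choice_2_inj\<close>), all of
  them in the language (\<open>word_in_language\<close>).

  If \<open>\<omega>\<close> had a dense orbit, then every block of the language would occur in \<open>\<omega>\<close>, so one finite
  window of \<open>\<omega>\<close> would contain all these \<open>2 ^ n\<close> words. This window is itself a block for one single
  ordering, which for large \<open>n\<close> has not enough factors of that length.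
\<close>

section \<open>Words of the vertices\<close>

text \<open>The 1-coding read along all finite paths from the root to the vertex \<open>(x, y)\<close>, in increasing
  order: the paths through the smaller of the two entering edges come first. On the axes there is
  one path only; the root gets an arbitrary letter.\<close>
fun word :: "ordering \<Rightarrow> nat \<Rightarrow> nat \<Rightarrow> letter list" where
  "word \<xi> x 0 = [letter.a]"
| "word \<xi> 0 (Suc y) = [letter.b]"
| "word \<xi> (Suc x) (Suc y) =
     (if \<xi> (Suc x, Suc y) then word \<xi> x (Suc y) @ word \<xi> (Suc x) y
      else word \<xi> (Suc x) y @ word \<xi> x (Suc y))"

lemma word_0: "y \<ge> 1 \<Longrightarrow> word \<xi> 0 y = [letter.b]"
  by (cases y) auto

lemma length_word: "length (word \<xi> x y) = (x + y) choose x"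
  by (induction \<xi> x y rule: word.induct) (auto simp: add.commute)

lemma length_word_ge: "x \<ge> 1 \<Longrightarrow> y \<ge> 1 \<Longrightarrow> x + y \<le> length (word \<xi> x y)"
proof (induction \<xi> x y rule: word.induct)
  case (3 \<xi> x y)
  have "x + y + 1 \<le> length (word \<xi> x (Suc y))" if "x \<noteq> 0"
    using 3 that by (cases "\<xi> (Suc x, Suc y)") auto
  moreover have "x + y + 1 \<le> length (word \<xi> (Suc x) y)" if "y \<noteq> 0"
    using 3 that by (cases "\<xi> (Suc x, Suc y)") auto
  moreover have "length (word \<xi> x (Suc y)) > 0" "length (word \<xi> (Suc x) y) > 0"
    by (simp_all only: length_word) (auto simp del: binomial_Suc_Suc)
  ultimately show ?case
    by (cases "x = 0"; cases "y = 0") (auto simp del: length_greater_0_conv)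
qed auto

text \<open>Reversing every comparison of edges reverses the order of the paths. It reduces statements
  about suffixes to statements about prefixes.\<close>
lemma word_opposite: "word (\<lambda>v. \<not> \<xi> v) x y = rev (word \<xi> x y)"
  by (induction \<xi> x y rule: word.induct) auto


section \<open>The 1-coding on fibers of paths\<close>

definition first_letter :: "path \<Rightarrow> letter" where
  "first_letter \<gamma> = (if \<gamma> 0 = ((0, 0), (1, 0)) then letter.a else letter.b)"

text \<open>The paths that have the edges of \<open>\<gamma>\<close> from index \<open>n\<close> on: the finite paths to the source of the
  edge \<open>\<gamma> n\<close>, prolonged by a common tail so that the order on infinite paths applies to them.\<close>
definition fiber :: "path \<Rightarrow> nat \<Rightarrow> path set" where
  "fiber \<gamma> n = {\<zeta> \<in> pascal_paths. \<forall>m\<ge>n. \<zeta> m = \<gamma> m}"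

lemma pascal_path_root: "\<gamma> \<in> pascal_paths \<Longrightarrow> fst (\<gamma> 0) = (0, 0)"
  by (simp add: pascal_paths_def)

lemma pascal_pathsD:
  assumes "\<gamma> \<in> pascal_paths"
  shows "\<gamma> n \<in> pascal_edges" "fst (\<gamma> (Suc n)) = snd (\<gamma> n)"
  using assms by (auto simp: pascal_paths_def)

lemma edges_into_boundary:
  "e \<in> pascal_edges \<Longrightarrow> snd e = (Suc x, 0) \<Longrightarrow> e = ((x, 0), (Suc x, 0))"
  "e \<in> pascal_edges \<Longrightarrow> snd e = (0, Suc y) \<Longrightarrow> e = ((0, y), (0, Suc y))"
  by (auto simp: pascal_edges_def)

lemma edges_into_interior:
  "e \<in> pascal_edges \<Longrightarrow> snd e = (Suc x, Suc y) \<Longrightarrow>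
     e = ((x, Suc y), (Suc x, Suc y)) \<or> e = ((Suc x, y), (Suc x, Suc y))"
  by (auto simp: pascal_edges_def)

lemma fiber_Suc_boundary:
  assumes g: "\<gamma> \<in> pascal_paths" and v: "fst (\<gamma> (Suc n)) = (x, 0) \<or> fst (\<gamma> (Suc n)) = (0, y)"
  shows "fiber \<gamma> (Suc n) = fiber \<gamma> n"
proof -
  have "\<zeta> n = \<gamma> n" if z: "\<zeta> \<in> pascal_paths" "\<zeta> (Suc n) = \<gamma> (Suc n)" for \<zeta>
  proof -
    have e: "\<zeta> n \<in> pascal_edges" "\<gamma> n \<in> pascal_edges" "snd (\<zeta> n) = snd (\<gamma> n)"
      "snd (\<gamma> n) = fst (\<gamma> (Suc n))"
      using pascal_pathsD[OF g] pascal_pathsD[OF z(1)] z(2) by auto metis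
    have "snd (\<gamma> n) \<noteq> (0, 0)" using e(2) by (auto simp: pascal_edges_def)
    then show ?thesis using e v edges_into_boundary
      by (metis old.nat.exhaust)
  qed
  then have "(\<forall>m\<ge>Suc n. \<zeta> m = \<gamma> m) \<longleftrightarrow> (\<forall>m\<ge>n. \<zeta> m = \<gamma> m)" if "\<zeta> \<in> pascal_paths" for \<zeta>
    using that by (metis Suc_le_eq le_eq_less_or_eq order_refl)
  then show ?thesis unfolding fiber_def by blast
qed

lemma fiber_Suc_step:
  assumes "\<zeta> \<in> pascal_paths" "\<forall>m>n. \<zeta> m = \<gamma> m"
  shows "fiber \<zeta> n = {\<eta> \<in> fiber \<gamma> (Suc n). \<eta> n = \<zeta> n}"
proof -
  have "(\<forall>m\<ge>n. \<eta> m = \<zeta> m) \<longleftrightarrow> (\<forall>m\<ge>Suc n. \<eta> m = \<gamma> m) \<and> \<eta> n = \<zeta> n" for \<eta>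
    using assms(2) by (metis Suc_le_eq le_eq_less_or_eq)
  then show ?thesis by (auto simp: fiber_def)
qed

text \<open>The recursion of \<open>word\<close> is the splitting of a fiber by its last free edge: every path through
  the smaller edge is below every path through the larger one, since all later edges agree.\<close>
lemma fiber_enumeration:
  assumes "\<gamma> \<in> pascal_paths" "n \<ge> 1" "fst (\<gamma> n) = (x, y)"
  shows "\<exists>xs. set xs = fiber \<gamma> n \<and> sorted_wrt (path_less \<xi>) xs \<and> map first_letter xs = word \<xi> x y"
  using assms(2,1,3)
proof (induction n arbitrary: \<gamma> x y rule: dec_induct)
  case base
  have "fiber \<gamma> 1 = {\<gamma>}"
  proof -
    have "\<zeta> = \<gamma>" if z: "\<zeta> \<in> pascal_paths" "\<forall>m\<ge>1. \<zeta> m = \<gamma> m" for \<zeta>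
    proof
      fix m
      show "\<zeta> m = \<gamma> m"
      proof (cases m)
        case 0
        have "fst (\<zeta> 0) = fst (\<gamma> 0)" "snd (\<zeta> 0) = snd (\<gamma> 0)"
          using pascal_path_root pascal_pathsD(2)[of _ 0] base(1) z by (metis, metis One_nat_def order_refl)
        then show ?thesis using 0 by (simp add: prod_eq_iff)
      next
        case (Suc k)
        then show ?thesis using z(2) by simp
      qed
    qed
    then show ?thesis using base(1) by (auto simp: fiber_def)
  qed
  moreover have "fst (\<gamma> 0) = (0, 0)" "\<gamma> 0 \<in> pascal_edges" "snd (\<gamma> 0) = (x, y)"
    using pascal_path_root[OF base(1)] pascal_pathsD[OF base(1), of 0] base(2) by auto
  then have "[first_letter \<gamma>] = word \<xi> x y"
    by (auto simp: first_letter_def pascal_edges_def)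
  ultimately show ?case by (intro exI[of _ "[\<gamma>]"]) auto
next
  case (step n)
  have e: "\<gamma> n \<in> pascal_edges" "snd (\<gamma> n) = (x, y)"
    using pascal_pathsD[OF step(4), of n] step(5) by auto
  show ?case
  proof (cases "x = 0 \<or> y = 0")
    case True
    have fib: "fiber \<gamma> (Suc n) = fiber \<gamma> n"
      using fiber_Suc_boundary[OF step(4), of n x y] True step(5) by auto
    obtain x' y' where v: "fst (\<gamma> n) = (x', y')" by (cases "fst (\<gamma> n)")
    have "x' + y' = n" using pascal_path_level[OF step(4), of n] v by simp
    then have "word \<xi> x' y' = word \<xi> x y"
      using e v True \<open>1 \<le> n\<close> by (auto simp: pascal_edges_def word_0)
    then show ?thesis using step.IH[OF step(4) v] fib by simp
  next
    case False
    then obtain x' y' where xy: "x = Suc x'" "y = Suc y'" by (metis not0_implies_Suc)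
    \<comment> \<open>Redirecting \<open>\<gamma>\<close> through either entering edge gives the tails for which the induction
      hypothesis enumerates the two halves of the fiber.\<close>
    define e1 where "e1 = ((x', Suc y'), (Suc x', Suc y'))"
    define e2 where "e2 = ((Suc x', y'), (Suc x', Suc y'))"
    have ed: "e1 \<in> pascal_edges" "e2 \<in> pascal_edges" "snd e1 = snd (\<gamma> n)" "snd e2 = snd (\<gamma> n)"
      using e xy by (auto simp: pascal_edges_def e1_def e2_def)
    obtain \<zeta>1 where z1: "\<zeta>1 \<in> pascal_paths" "\<zeta>1 n = e1" "\<forall>m>n. \<zeta>1 m = \<gamma> m"
      using ex_path_through[OF step(4) ed(1,3)] by blast
    obtain \<zeta>2 where z2: "\<zeta>2 \<in> pascal_paths" "\<zeta>2 n = e2" "\<forall>m>n. \<zeta>2 m = \<gamma> m"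
      using ex_path_through[OF step(4) ed(2,4)] by blast
    obtain xs1 where x1: "set xs1 = fiber \<zeta>1 n" "sorted_wrt (path_less \<xi>) xs1"
        "map first_letter xs1 = word \<xi> x' (Suc y')"
      using step.IH[OF z1(1), of x' "Suc y'"] z1(2) by (auto simp: e1_def)
    obtain xs2 where x2: "set xs2 = fiber \<zeta>2 n" "sorted_wrt (path_less \<xi>) xs2"
        "map first_letter xs2 = word \<xi> (Suc x') y'"
      using step.IH[OF z2(1), of "Suc x'" y'] z2(2) by (auto simp: e2_def)
    have s1: "set xs1 = {\<eta> \<in> fiber \<gamma> (Suc n). \<eta> n = e1}"
      and s2: "set xs2 = {\<eta> \<in> fiber \<gamma> (Suc n). \<eta> n = e2}"
      using fiber_Suc_step[OF z1(1,3)] fiber_Suc_step[OF z2(1,3)] x1(1) x2(1) z1(2) z2(2) by auto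
    have "\<eta> n = e1 \<or> \<eta> n = e2" if "\<eta> \<in> fiber \<gamma> (Suc n)" for \<eta>
    proof -
      have h: "\<eta> \<in> pascal_paths" "\<eta> (Suc n) = \<gamma> (Suc n)" using that by (auto simp: fiber_def)
      then show ?thesis using pascal_pathsD[OF h(1), of n] step(5) xy edges_into_interior
        unfolding e1_def e2_def by metis
    qed
    then have un: "set xs1 \<union> set xs2 = fiber \<gamma> (Suc n)" using s1 s2 by blast
    have less: "path_less \<xi> \<alpha> \<beta>"
      if "\<alpha> \<in> fiber \<gamma> (Suc n)" "\<beta> \<in> fiber \<gamma> (Suc n)" "edge_less \<xi> (\<alpha> n) (\<beta> n)" for \<alpha> \<beta>
      unfolding path_less_def using that by (intro exI[of _ n]) (auto simp: fiber_def Suc_le_eq)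
    show ?thesis
    proof (cases "\<xi> (x, y)")
      case True
      then have el: "edge_less \<xi> e1 e2" unfolding edge_less_def e1_def e2_def xy
        by (intro exI[of _ "Suc x'"] exI[of _ "Suc y'"] conjI) auto
      then have "sorted_wrt (path_less \<xi>) (xs1 @ xs2)"
        using x1(2) x2(2) s1 s2 less by (auto simp: sorted_wrt_append)
      then show ?thesis using True un x1(3) x2(3) xy by (intro exI[of _ "xs1 @ xs2"]) auto
    next
      case False
      then have el: "edge_less \<xi> e2 e1" unfolding edge_less_def e1_def e2_def xy
        by (intro exI[of _ "Suc x'"] exI[of _ "Suc y'"] conjI) auto
      then have "sorted_wrt (path_less \<xi>) (xs2 @ xs1)"
        using x1(2) x2(2) s1 s2 less by (auto simp: sorted_wrt_append)
      then show ?thesis using False un x1(3) x2(3) xy by (intro exI[of _ "xs2 @ xs1"]) auto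
    qed
  qed
qed

text \<open>A path outside the fiber that exceeds one of its members differs from all members at the same
  last index, so it exceeds them all and cannot come between two of them: within a fiber, the adic
  map is the successor in the enumeration.\<close>
lemma adic_enumeration:
  assumes xs: "set xs = fiber \<gamma> n" "sorted_wrt (path_less \<xi>) xs" and i: "Suc i < length xs"
  shows "adic \<xi> (xs ! i) = Some (xs ! Suc i)"
proof -
  have mem: "xs ! i \<in> fiber \<gamma> n" "xs ! Suc i \<in> fiber \<gamma> n" using i xs(1) by (metis Suc_lessD nth_mem)+
  have lt: "path_less \<xi> (xs ! i) (xs ! Suc i)" using sorted_wrt_nth_less[OF xs(2) _ i, of i] by simp
  have "xs ! Suc i = \<zeta> \<or> path_less \<xi> (xs ! Suc i) \<zeta>"
    if z: "\<zeta> \<in> pascal_paths" "path_less \<xi> (xs ! i) \<zeta>" for \<zeta>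
  proof -
    obtain m where m: "edge_less \<xi> ((xs ! i) m) (\<zeta> m)" "\<forall>j>m. (xs ! i) j = \<zeta> j"
      using z(2) unfolding path_less_def by blast
    show ?thesis
    proof (cases "m \<ge> n")
      case True
      then have "edge_less \<xi> ((xs ! Suc i) m) (\<zeta> m)" "\<forall>j>m. (xs ! Suc i) j = \<zeta> j"
        using mem m by (auto simp: fiber_def)
      then show ?thesis unfolding path_less_def by blast
    next
      case False
      then have "\<zeta> \<in> fiber \<gamma> n" using z(1) mem(1) m(2) by (auto simp: fiber_def)
      then obtain j where j: "j < length xs" "\<zeta> = xs ! j" using xs(1) by (metis in_set_conv_nth)
      have "\<not> j \<le> i"
      proof
        assume "j \<le> i"
        then have "\<zeta> = xs ! i \<or> path_less \<xi> \<zeta> (xs ! i)"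
          using sorted_wrt_nth_less[OF xs(2), of j i] i j by (cases "j = i") auto
        then show False using z(2) path_less_trans path_less_irrefl by blast
      qed
      then have "j = Suc i \<or> Suc i < j" by auto
      then show ?thesis using sorted_wrt_nth_less[OF xs(2), of "Suc i" j] j by auto
    qed
  qed
  moreover have "xs ! i \<in> pascal_paths" "xs ! Suc i \<in> pascal_paths" using mem by (auto simp: fiber_def)
  ultimately show ?thesis using lt by (auto simp: adic_eq_Some_iff smallest_above_def)
qed

lemma adic_paths:
  assumes "\<gamma> \<in> pascal_paths" "adic \<xi> \<gamma> = Some \<eta>"
  shows "\<eta> \<in> pascal_paths" "path_less \<xi> \<gamma> \<eta>"
  using assms by (auto simp: adic_eq_Some_iff smallest_above_def)

lemma adic_inv_SomeD:
  assumes "\<gamma> \<in> pascal_paths" "adic_inv \<xi> \<gamma> = Some \<eta>"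
  shows "\<eta> \<in> pascal_paths" "adic \<xi> \<eta> = Some \<gamma>"
proof -
  have nm: "\<not> (\<forall>n. minimal_edge \<xi> (\<gamma> n))" and
    eta: "\<eta> = (THE \<eta>. \<eta> \<in> pascal_paths \<and> adic \<xi> \<eta> = Some \<gamma>)"
    using assms(2) by (auto simp: adic_inv_def split: if_splits)
  show "\<eta> \<in> pascal_paths" "adic \<xi> \<eta> = Some \<gamma>"
    using theI'[OF ex1_adic_preimage[OF assms(1) nm]] eta by auto
qed

lemma adic_pow_0: "adic_pow \<xi> 0 \<gamma> = Some \<gamma>"
  by (simp add: adic_pow_def)

lemma adic_pow_nonneg_Suc: "0 \<le> k \<Longrightarrow> adic_pow \<xi> (k + 1) \<gamma> = Option.bind (adic_pow \<xi> k \<gamma>) (adic \<xi>)"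
  by (simp add: adic_pow_def nat_add_distrib)

lemma adic_pow_neg: "k < 0 \<Longrightarrow> adic_pow \<xi> k \<gamma> = Option.bind (adic_pow \<xi> (k + 1) \<gamma>) (adic_inv \<xi>)"
proof -
  assume "k < 0"
  then have "nat (- k) = Suc (nat (- (k + 1)))" by auto
  then show ?thesis using \<open>k < 0\<close> by (cases "k = - 1") (auto simp: adic_pow_def)
qed

lemma adic_pow_path:
  assumes g: "\<gamma> \<in> pascal_paths"
  shows "adic_pow \<xi> k \<gamma> = Some \<eta> \<Longrightarrow> \<eta> \<in> pascal_paths"
proof (induction k arbitrary: \<eta> rule: int_induct[where k = 0])
  case base
  then show ?case using g by (simp add: adic_pow_0)
next
  case (step1 i)
  then show ?case by (auto simp: adic_pow_nonneg_Suc bind_eq_Some_conv intro: adic_paths)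
next
  case (step2 i)
  then show ?case by (auto simp: adic_pow_neg bind_eq_Some_conv intro: adic_inv_SomeD)
qed

text \<open>Positive powers iterate \<open>adic\<close> and negative powers iterate \<open>adic_inv\<close>; for both, raising the
  exponent by one is an application of \<open>adic\<close>, so a window of the coding can be read forwards.\<close>
lemma adic_pow_Suc:
  assumes g: "\<gamma> \<in> pascal_paths" and k: "adic_pow \<xi> k \<gamma> = Some \<eta>"
  shows "adic_pow \<xi> (k + 1) \<gamma> = adic \<xi> \<eta>"
proof (cases "0 \<le> k")
  case True
  then show ?thesis using k by (simp add: adic_pow_nonneg_Suc)
next
  case False
  then obtain \<zeta> where "adic_pow \<xi> (k + 1) \<gamma> = Some \<zeta>" "adic_inv \<xi> \<zeta> = Some \<eta>"
    using k by (auto simp: adic_pow_neg bind_eq_Some_conv)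
  then show ?thesis using adic_inv_SomeD adic_pow_path[OF g] by metis
qed

text \<open>The finitely many paths read in a window eventually coincide, so for large \<open>n\<close> they all
  lie in one fiber. There they are consecutive, and the block is read off the word of a vertex.\<close>
lemma found_in_coding_factor:
  assumes g: "\<gamma> \<in> pascal_paths" and f: "found_in_coding u (coding \<xi> \<gamma>)"
  shows "\<exists>x y. sublist u (word \<xi> x y)"
proof (cases "u = []")
  case False
  obtain k where k: "\<And>i. i < length u \<Longrightarrow> coding \<xi> \<gamma> (k + int i) = Some (u ! i)"
    using f unfolding found_in_coding_def by blast
  define p where "p i = the (adic_pow \<xi> (k + int i) \<gamma>)" for i
  have p: "adic_pow \<xi> (k + int i) \<gamma> = Some (p i)" "u ! i = first_letter (p i)" if "i < length u" for i
    using k[OF that] by (auto simp: coding_def p_def first_letter_def)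
  have pp: "p i \<in> pascal_paths" if "i < length u" for i
    using adic_pow_path[OF g p(1)[OF that]] .
  have next_p: "adic \<xi> (p i) = Some (p (Suc i))" if "Suc i < length u" for i
    using adic_pow_Suc[OF g p(1)[of i]] p(1)[OF that] that by (simp add: add.commute add.left_commute)
  have "\<exists>n. \<forall>i\<le>l. \<forall>m\<ge>n. p i m = p 0 m" if "l < length u" for l
    using that
  proof (induction l)
    case (Suc l)
    then obtain n where n: "\<forall>i\<le>l. \<forall>m\<ge>n. p i m = p 0 m" by auto
    have "path_less \<xi> (p l) (p (Suc l))" using adic_paths pp next_p Suc.prems by (meson Suc_lessD)
    then obtain n' where "\<forall>m>n'. p l m = p (Suc l) m" unfolding path_less_def by blast
    then have "p (Suc l) m = p 0 m" if "m \<ge> n + Suc n'" for m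
      using that n by (metis Suc_le_eq add_leD1 add_leD2 order_refl)
    then have "\<forall>i\<le>Suc l. \<forall>m\<ge>n + Suc n'. p i m = p 0 m"
      using n by (metis add_leD1 le_SucE)
    then show ?case by blast
  qed auto
  from this[of "length u - 1"] obtain n0 where n0: "\<forall>i\<le>length u - 1. \<forall>m\<ge>n0. p i m = p 0 m"
    using False by auto
  define n where "n = Suc n0"
  have fib: "p i \<in> fiber (p 0) n" if "i < length u" for i
  proof -
    have "i \<le> length u - 1" using that by simp
    then have "p i m = p 0 m" if "m \<ge> n" for m using n0 that unfolding n_def by (meson Suc_leD)
    then show ?thesis using pp[OF that] by (simp add: fiber_def)
  qed
  obtain x y where "fst (p 0 n) = (x, y)" by (cases "fst (p 0 n)")
  then obtain xs where xs: "set xs = fiber (p 0) n" "sorted_wrt (path_less \<xi>) xs"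
      "map first_letter xs = word \<xi> x y"
    using fiber_enumeration[of "p 0" n x y \<xi>] pp[of 0] False by (auto simp: n_def)
  obtain s where s: "s < length xs" "xs ! s = p 0"
    using fib[of 0] False xs(1) by (metis in_set_conv_nth length_greater_0_conv)
  have run: "s + i < length xs \<and> xs ! (s + i) = p i" if "i < length u" for i
    using that
  proof (induction i)
    case (Suc i)
    then have IH: "s + i < length xs" "xs ! (s + i) = p i" by auto
    have lt: "path_less \<xi> (p i) (p (Suc i))" using adic_paths pp next_p Suc.prems by (meson Suc_lessD)
    obtain j where j: "j < length xs" "xs ! j = p (Suc i)"
      using fib[OF Suc.prems] xs(1) by (metis in_set_conv_nth)
    \<comment> \<open>The enumeration has not reached its end, for \<open>p (Suc i)\<close> is a larger member of the fiber.\<close>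
    have "\<not> j \<le> s + i"
      using sorted_wrt_nth_less[OF xs(2), of j "s + i"] IH j lt path_less_trans path_less_irrefl
      by (metis le_neq_implies_less)
    then have "Suc (s + i) < length xs" using j by simp
    then have "adic \<xi> (p i) = Some (xs ! Suc (s + i))" using adic_enumeration[OF xs(1,2)] IH by metis
    then show ?case using next_p[OF Suc.prems] \<open>Suc (s + i) < length xs\<close> by simp
  qed (use s in simp)
  have "u = take (length u) (drop s (word \<xi> x y))"
  proof (rule nth_equalityI)
    have "s + (length u - 1) < length xs" using run[of "length u - 1"] False by simp
    then show len: "length u = length (take (length u) (drop s (word \<xi> x y)))"
      using False by (simp flip: xs(3))
    show "u ! i = take (length u) (drop s (word \<xi> x y)) ! i" if "i < length u" for i
      using run[OF that] p(2)[OF that] that by (simp flip: xs(3))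
  qed
  then show ?thesis by (metis sublist_order.order.trans sublist_drop sublist_take)
qed simp

text \<open>Started at the smallest path of a fiber, the adic map runs through the whole fiber.\<close>
lemma word_coding:
  assumes "x + y \<ge> 1"
  shows "\<exists>\<gamma>\<in>pascal_paths. \<forall>i<length (word \<xi> x y). coding \<xi> \<gamma> (int i) = Some (word \<xi> x y ! i)"
proof -
  \<comment> \<open>The path that goes along the first axis to \<open>(x, 0)\<close> and then straight through \<open>(x, y)\<close>.\<close>
  define v where "v i = (min i x, i - x)" for i :: nat
  define \<gamma> where "\<gamma> i = (v i, v (Suc i))" for i
  have "(v i, v (Suc i)) \<in> pascal_edges" for i
  proof (cases "i < x")
    case False
    then have "v i = (x, i - x)" "v (Suc i) = (x, (i - x) + 1)" by (auto simp: v_def)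
    then show ?thesis unfolding pascal_edges_def by blast
  qed (auto simp: v_def pascal_edges_def)
  then have g: "\<gamma> \<in> pascal_paths" by (auto simp: \<gamma>_def pascal_paths_def v_def)
  have "fst (\<gamma> (x + y)) = (x, y)" by (auto simp: \<gamma>_def v_def)
  then obtain xs where xs: "set xs = fiber \<gamma> (x + y)" "sorted_wrt (path_less \<xi>) xs"
      "map first_letter xs = word \<xi> x y"
    using fiber_enumeration[OF g assms] by blast
  have paths: "xs ! i \<in> pascal_paths" if "i < length xs" for i
    using nth_mem[OF that] xs(1) by (auto simp: fiber_def)
  have "\<gamma> \<in> set xs" using g by (simp add: xs fiber_def)
  then have 0: "0 < length xs" by (cases xs) auto
  have pow: "adic_pow \<xi> (int i) (xs ! 0) = Some (xs ! i)" if "i < length xs" for i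
    using that
  proof (induction i)
    case (Suc i)
    then have "adic_pow \<xi> (int i + 1) (xs ! 0) = adic \<xi> (xs ! i)"
      using adic_pow_Suc[OF paths[OF 0]] by simp
    also have "\<dots> = Some (xs ! Suc i)" using adic_enumeration[OF xs(1,2) Suc.prems] .
    finally show ?case by (simp add: add.commute)
  qed (simp add: adic_pow_0)
  have "coding \<xi> (xs ! 0) (int i) = Some (word \<xi> x y ! i)" if "i < length (word \<xi> x y)" for i
  proof -
    have "i < length xs" using that by (simp flip: xs(3))
    then show ?thesis using pow by (simp add: coding_def first_letter_def flip: xs(3))
  qed
  then show ?thesis using paths[OF 0] by blast
qed

lemma language_Sigma_ord_factor:
  assumes "u \<in> language (Sigma_ord \<xi>)"
  shows "\<exists>x y. sublist u (word \<xi> x y)"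
proof -
  obtain \<omega> k n where "\<omega> \<in> Sigma_ord \<xi>" "u = block \<omega> k n"
    using assms unfolding language_def by blast
  then obtain \<gamma> where "\<gamma> \<in> pascal_paths" "found_in_coding u (coding \<xi> \<gamma>)"
    unfolding Sigma_ord_def by blast
  then show ?thesis by (rule found_in_coding_factor)
qed


section \<open>Words in the language of an ordering\<close>

text \<open>The limit of words that grow on both sides. The numbers \<open>c k\<close> are the positions in \<open>w k\<close> at which
  \<open>w 0\<close> begins, so that \<open>w k\<close> occupies the coordinates from \<open>- c k\<close> on.\<close>
lemma nested_words_bisequence:
  fixes w l r :: "nat \<Rightarrow> 'a list"
  assumes step: "\<And>k. w (Suc k) = l k @ w k @ r k" and ne: "\<And>k. l k \<noteq> []" "\<And>k. r k \<noteq> []"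
  obtains \<omega> :: "int \<Rightarrow> 'a" and c :: "nat \<Rightarrow> nat" where
    "\<And>k i. i < length (w k) \<Longrightarrow> \<omega> (int i - int (c k)) = w k ! i"
    "\<And>k. k \<le> c k" "\<And>k. c k + k \<le> length (w k)" "c 0 = 0"
proof -
  define c where "c k = (\<Sum>j<k. length (l j))" for k
  have pos: "length (l k) \<ge> 1" "length (r k) \<ge> 1" for k using ne by (simp_all add: Suc_leI)
  have c1: "k \<le> c k" for k
  proof (induction k)
    case (Suc k)
    then show ?case using pos(1)[of k] by (simp add: c_def)
  qed simp
  have c2: "c k + k \<le> length (w k)" for k
  proof (induction k)
    case (Suc k)
    then show ?case using pos(2)[of k] by (simp add: c_def step)
  qed (simp add: c_def)
  have cons: "i < length (w k) \<Longrightarrow> i + (c (k + d) - c k) < length (w (k + d)) \<and> c k \<le> c (k + d) \<and>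
      w (k + d) ! (i + (c (k + d) - c k)) = w k ! i" for i k d
  proof (induction d)
    case (Suc d)
    then have IH: "i + (c (k + d) - c k) < length (w (k + d))" "c k \<le> c (k + d)"
      "w (k + d) ! (i + (c (k + d) - c k)) = w k ! i" by auto
    have "i + (c (k + Suc d) - c k) = length (l (k + d)) + (i + (c (k + d) - c k))"
      using IH(2) by (simp add: c_def)
    moreover have "c k \<le> c (k + Suc d)" using IH(2) by (simp add: c_def)
    ultimately show ?case using IH(1,3) by (simp add: step nth_append)
  qed simp
  \<comment> \<open>An index at which the word is long enough on both sides to cover the coordinate \<open>i\<close>.\<close>
  define K where "K i = nat \<bar>i\<bar> + 1" for i :: int
  define \<omega> where "\<omega> i = w (K i) ! nat (i + int (c (K i)))" for i
  have "\<omega> (int i - int (c k)) = w k ! i" if i: "i < length (w k)" for i k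
  proof -
    define j where "j = int i - int (c k)"
    define i' where "i' = nat (j + int (c (K j)))"
    have "int (K j) = \<bar>j\<bar> + 1" by (simp add: K_def)
    then have "0 \<le> j + int (c (K j))" "j + int (c (K j)) < int (length (w (K j)))"
      using c1[of "K j"] c2[of "K j"] by linarith+
    then have i': "int i' = j + int (c (K j))" "i' < length (w (K j))"
      by (auto simp: i'_def nat_less_iff)
    define M where "M = k + K j"
    have "c k \<le> c M" "w M ! (i + (c M - c k)) = w k ! i"
      using cons[OF i, of "K j"] by (auto simp: M_def)
    moreover have "c (K j) \<le> c M" "w M ! (i' + (c M - c (K j))) = w (K j) ! i'"
      using cons[OF i'(2), of k] by (auto simp: M_def add.commute)
    moreover have "i' + (c M - c (K j)) = i + (c M - c k)"
      using i'(1) \<open>c k \<le> c M\<close> \<open>c (K j) \<le> c M\<close> unfolding j_def by linarith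
    ultimately show ?thesis by (simp add: \<omega>_def j_def i'_def)
  qed
  moreover have "c 0 = 0" by (simp add: c_def)
  ultimately show ?thesis using c1 c2 that by metis
qed

text \<open>If the ordering is 0 in all columns beyond \<open>x\<close>, then the words at \<open>(x + k, y + k)\<close> form a
  chain that grows strictly on both sides: in \<open>word \<xi> (Suc x) (Suc y)\<close>, the word of \<open>(x, y)\<close> is the
  last part of the word of \<open>(Suc x, y)\<close>, which is followed by the word of \<open>(x, Suc y)\<close>. The limit of the
  chain is a two-sided sequence in which the first word occurs.\<close>
lemma word_in_language:
  assumes \<xi>: "\<And>i j. i > x \<Longrightarrow> \<not> \<xi> (i, j)" and y: "y \<ge> 1"
  shows "word \<xi> x y \<in> language (Sigma_ord \<xi>)"
proof -
  define w where "w k = word \<xi> (x + k) (y + k)" for k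
  have ne: "word \<xi> i j \<noteq> []" for i j
    by (simp add: length_word flip: length_greater_0_conv)
  define l where "l k = word \<xi> (Suc (x + k)) (y + k - 1)" for k
  define r where "r k = word \<xi> (x + k) (Suc (y + k))" for k
  have step: "w (Suc k) = l k @ w k @ r k" for k
  proof -
    obtain j where j: "y + k = Suc j" using y by (cases "y + k") auto
    show ?thesis unfolding w_def l_def r_def by (simp add: j \<xi>)
  qed
  obtain \<omega> c where \<omega>: "\<And>k i. i < length (w k) \<Longrightarrow> \<omega> (int i - int (c k)) = w k ! i"
    and c: "\<And>k. k \<le> c k" "\<And>k. c k + k \<le> length (w k)" "c 0 = 0"
    by (rule nested_words_bisequence[where w = w and l = l and r = r]) (auto simp: step l_def r_def ne)
  have "\<omega> \<in> Sigma_ord \<xi>"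
    unfolding Sigma_ord_def
  proof safe
    fix k n
    define K where "K = nat \<bar>k\<bar> + n"
    define s where "s = nat (k + int (c K))"
    have "int K = \<bar>k\<bar> + int n" by (simp add: K_def)
    then have s: "int s = k + int (c K)" "s + n \<le> length (w K)"
      using c(1)[of K] c(2)[of K] unfolding s_def by linarith+
    obtain \<gamma> where g: "\<gamma> \<in> pascal_paths" "\<forall>i<length (w K). coding \<xi> \<gamma> (int i) = Some (w K ! i)"
      using word_coding[of "x + K" "y + K" \<xi>] y by (auto simp: w_def)
    have "coding \<xi> \<gamma> (int s + int i) = Some (block \<omega> k n ! i)" if "i < n" for i
    proof -
      have "coding \<xi> \<gamma> (int (s + i)) = Some (w K ! (s + i))"
        using g(2) s(2) that by (meson add_less_cancel_left less_le_trans)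
      moreover have "block \<omega> k n ! i = w K ! (s + i)"
      proof -
        have "block \<omega> k n ! i = \<omega> (k + int i)" using that by (simp add: block_def)
        moreover have "k + int i = int (s + i) - int (c K)" using s(1) by simp
        ultimately show ?thesis using \<omega>[of "s + i" K] s(2) that by simp
      qed
      ultimately show ?thesis by simp
    qed
    then have "found_in_coding (block \<omega> k n) (coding \<xi> \<gamma>)" unfolding found_in_coding_def by auto
    then show "\<exists>\<gamma>\<in>pascal_paths. found_in_coding (block \<omega> k n) (coding \<xi> \<gamma>)" using g(1) by blast
  qed
  moreover have "block \<omega> 0 (length (w 0)) = w 0"
    using \<omega>[of _ 0] c(3) by (intro nth_equalityI) (auto simp: block_def)
  then have "word \<xi> x y = block \<omega> 0 (length (w 0))" by (simp add: w_def)
  ultimately show ?thesis unfolding language_def by blast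
qed


section \<open>Polynomial complexity for a single ordering\<close>

text \<open>The words of length \<open>j\<close> with at most one letter \<open>c\<close> and otherwise \<open>d\<close>; \<open>m = j\<close> gives the word
  without \<open>c\<close>.\<close>
definition lone_words :: "letter \<Rightarrow> letter \<Rightarrow> nat \<Rightarrow> letter list set" where
  "lone_words c d j = (\<lambda>m. map (\<lambda>i. if i = m then c else d) [0..<j]) ` {..j}"

lemma card_lone_words: "finite (lone_words c d j)" "card (lone_words c d j) \<le> j + 1"
  unfolding lone_words_def using card_image_le[of "{..j}"] by auto

lemma prefix_lone:
  assumes "prefix p (replicate m d @ c # replicate n d)"
  shows "p \<in> lone_words c d (length p)"
  unfolding lone_words_def
proof (rule image_eqI)
  obtain r where r: "replicate m d @ c # replicate n d = p @ r" using assms by (auto simp: prefix_def)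
  have "p ! i = (if i = m then c else d)" if "i < length p" for i
  proof -
    have "length p \<le> m + Suc n" using arg_cong[OF r, of length] by simp
    then have "(replicate m d @ c # replicate n d) ! i = (if i = m then c else d)"
      using that by (auto simp: nth_append nth_Cons split: nat.split)
    then show ?thesis using that by (simp add: r nth_append)
  qed
  then show "p = map (\<lambda>i. if i = min m (length p) then c else d) [0..<length p]"
    by (intro nth_equalityI) (auto simp: min_def)
qed simp

lemma word_1: "\<exists>m n. word \<xi> 1 y = replicate m letter.b @ letter.a # replicate n letter.b"
proof (induction y)
  case 0
  have "word \<xi> 1 0 = replicate 0 letter.b @ letter.a # replicate 0 letter.b" by simp
  then show ?case by blast
next
  case (Suc y)
  then obtain m n where "word \<xi> 1 y = replicate m letter.b @ letter.a # replicate n letter.b" by blast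
  then have "word \<xi> 1 (Suc y) = (if \<xi> (1, Suc y)
      then replicate (Suc m) letter.b @ letter.a # replicate n letter.b
      else replicate m letter.b @ letter.a # replicate (Suc n) letter.b)"
    by (simp add: replicate_append_same)
  then show ?case by metis
qed

lemma word_1': "\<exists>m n. word \<xi> x 1 = replicate m letter.a @ letter.b # replicate n letter.a"
proof (induction x)
  case 0
  have "word \<xi> 0 1 = replicate 0 letter.a @ letter.b # replicate 0 letter.a" by simp
  then show ?case by blast
next
  case (Suc x)
  then obtain m n where "word \<xi> x 1 = replicate m letter.a @ letter.b # replicate n letter.a" by blast
  then have "word \<xi> (Suc x) 1 = (if \<xi> (Suc x, 1)
      then replicate m letter.a @ letter.b # replicate (Suc n) letter.a
      else replicate (Suc m) letter.a @ letter.b # replicate n letter.a)"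
    by (simp add: replicate_append_same)
  then show ?case by metis
qed

definition word_prefixes :: "ordering \<Rightarrow> nat \<Rightarrow> letter list set" where
  "word_prefixes \<xi> j = {p. length p = j \<and> (\<exists>x y. prefix p (word \<xi> x y))}"

text \<open>The vertices are infinitely many, but few of them contribute new prefixes of a given length.
  The word at an interior vertex begins with the word at one of its predecessors; as long as that
  predecessor has a word at least as long as \<open>p\<close>, descend to it. The descent ends either at a vertex
  whose predecessor has a word shorter than \<open>p\<close>, so that its coordinates are at most \<open>length p\<close>, or
  on or next to an axis, where all letters of a word but one coincide.\<close>
lemma prefix_word_cases:
  assumes "prefix p (word \<xi> x y)"
  shows "p \<in> (\<lambda>(x, y). take (length p) (word \<xi> x y)) ` ({..length p} \<times> {..length p})
             \<union> lone_words letter.a letter.b (length p) \<union> lone_words letter.b letter.a (length p)"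
  using assms
proof (induction \<xi> x y rule: word.induct)
  case (1 \<xi> x)
  then show ?case using prefix_lone[of p 0 letter.b letter.a 0] by simp
next
  case (2 \<xi> y)
  then show ?case using prefix_lone[of p 0 letter.a letter.b 0] by simp
next
  case (3 \<xi> x y)
  show ?case
  proof (cases "x = 0 \<or> y = 0")
    case True
    then show ?thesis
    proof
      assume "x = 0"
      then obtain m n where "word \<xi> (Suc x) (Suc y) = replicate m letter.b @ letter.a # replicate n letter.b"
        using word_1[of \<xi> "Suc y"] unfolding One_nat_def by blast
      then show ?thesis using prefix_lone 3(5) by (metis UnI1 UnI2)
    next
      assume "y = 0"
      then obtain m n where "word \<xi> (Suc x) (Suc y) = replicate m letter.a @ letter.b # replicate n letter.a"
        using word_1'[of \<xi> "Suc x"] unfolding One_nat_def by blast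
      then show ?thesis using prefix_lone 3(5) by (metis UnI1 UnI2)
    qed
  next
    case False
    define u where "u = (if \<xi> (Suc x, Suc y) then word \<xi> x (Suc y) else word \<xi> (Suc x) y)"
    define v where "v = (if \<xi> (Suc x, Suc y) then word \<xi> (Suc x) y else word \<xi> x (Suc y))"
    have "prefix p (u @ v)" using 3(5) by (auto simp: u_def v_def)
    then consider "prefix p u" | "length u \<le> length p" by (auto simp: prefix_append)
    then show ?thesis
    proof cases
      case 1
      then show ?thesis using 3(1,3) by (cases "\<xi> (Suc x, Suc y)") (auto simp: u_def)
    next
      case 2
      have "x + y + 1 \<le> length u"
        using False length_word_ge[of x "Suc y" \<xi>] length_word_ge[of "Suc x" y \<xi>] by (auto simp: u_def)
      with 2 False have "(Suc x, Suc y) \<in> {..length p} \<times> {..length p}" by auto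
      moreover have "p = take (length p) (word \<xi> (Suc x) (Suc y))"
        using 3(5) by (metis append_eq_conv_conj prefix_def)
      then have "p = (\<lambda>(x, y). take (length p) (word \<xi> x y)) (Suc x, Suc y)"
        unfolding prod.case .
      ultimately show ?thesis by blast
    qed
  qed
qed

lemma card_word_prefixes: "finite (word_prefixes \<xi> j)" "card (word_prefixes \<xi> j) \<le> 3 * (j + 1)\<^sup>2"
proof -
  define A where "A = (\<lambda>(x, y). take j (word \<xi> x y)) ` ({..j} \<times> {..j})"
  define C where "C = lone_words letter.a letter.b j"
  define D where "D = lone_words letter.b letter.a j"
  have sub: "word_prefixes \<xi> j \<subseteq> A \<union> C \<union> D"
    using prefix_word_cases unfolding word_prefixes_def A_def C_def D_def by blast
  have fin: "finite A" "finite C" "finite D"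
    by (auto simp: A_def C_def D_def card_lone_words)
  then show "finite (word_prefixes \<xi> j)" using sub by (meson finite_UnI finite_subset)
  have "card A \<le> (j + 1)\<^sup>2"
    unfolding A_def by (rule order_trans[OF card_image_le]) (auto simp: power2_eq_square)
  moreover have "j + 1 \<le> (j + 1)\<^sup>2" by (simp add: power2_eq_square)
  moreover have "card C \<le> j + 1" "card D \<le> j + 1" unfolding C_def D_def by (rule card_lone_words)+
  moreover have "card (word_prefixes \<xi> j) \<le> card (A \<union> C \<union> D)"
    using sub fin by (intro card_mono) auto
  moreover have "card (A \<union> C \<union> D) \<le> card A + card C + card D"
    using card_Un_le[of "A \<union> C" D] card_Un_le[of A C] by linarith
  ultimately show "card (word_prefixes \<xi> j) \<le> 3 * (j + 1)\<^sup>2" by linarith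
qed

text \<open>Descend to a predecessor as long as its word still contains the factor; at the end, the
  concatenation cuts the factor in two.\<close>
lemma factor_word_split:
  assumes "sublist u (word \<xi> x y)"
  shows "\<exists>p q x y x' y'. u = p @ q \<and> suffix p (word \<xi> x y) \<and> prefix q (word \<xi> x' y')"
  using assms
proof (induction \<xi> x y rule: word.induct)
  case (1 \<xi> x)
  then have "suffix u (word \<xi> x 0)" by (auto simp: sublist_Cons_right prefix_Cons)
  then show ?case by (metis append_Nil2 Nil_prefix)
next
  case (2 \<xi> y)
  then have "suffix u (word \<xi> 0 (Suc y))" by (auto simp: sublist_Cons_right prefix_Cons)
  then show ?case by (metis append_Nil2 Nil_prefix)
next
  case (3 \<xi> x y)
  then show ?case
    by (cases "\<xi> (Suc x, Suc y)") (simp_all add: sublist_append, blast+)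
qed

text \<open>There are at most \<open>n + 1\<close> positions for the cut, and for each of them quadratically many suffixes
  and quadratically many prefixes.\<close>
lemma card_factors_word:
  assumes S: "\<And>u. u \<in> S \<Longrightarrow> length u = n \<and> (\<exists>x y. sublist u (word \<xi> x y))"
  shows "card S \<le> 9 * (n + 1) ^ 5"
proof -
  let ?\<eta> = "\<lambda>v. \<not> \<xi> v"
  define P where "P i = word_prefixes ?\<eta> i \<times> word_prefixes \<xi> (n - i)" for i
  have finP: "finite (P i)" for i by (auto simp: P_def card_word_prefixes)
  have "S \<subseteq> (\<lambda>(p, q). rev p @ q) ` (\<Union>i\<le>n. P i)"
  proof
    fix u assume u: "u \<in> S"
    then obtain p q x y x' y' where pq: "u = p @ q" "suffix p (word \<xi> x y)" "prefix q (word \<xi> x' y')"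
      using S factor_word_split by meson
    have "prefix (rev p) (word ?\<eta> x y)" using pq(2) by (simp add: word_opposite suffix_to_prefix)
    then have "(rev p, q) \<in> P (length p)" "length p \<le> n"
      using S[OF u] pq by (auto simp: P_def word_prefixes_def)
    then show "u \<in> (\<lambda>(p, q). rev p @ q) ` (\<Union>i\<le>n. P i)"
      using pq(1) by (intro image_eqI[of _ _ "(rev p, q)"]) auto
  qed
  then have "card S \<le> card (\<Union>i\<le>n. P i)"
    using finP by (meson card_image_le card_mono finite_UN finite_atMost finite_imageI le_trans)
  also have "\<dots> \<le> (\<Sum>i\<le>n. card (P i))" by (rule card_UN_le) simp
  also have "\<dots> \<le> (\<Sum>i\<le>n. 9 * (n + 1) ^ 4)"
  proof (rule sum_mono)
    fix i assume i: "i \<in> {..n}"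
    have "card (P i) \<le> (3 * (i + 1)\<^sup>2) * (3 * (n - i + 1)\<^sup>2)"
      unfolding P_def card_cartesian_product by (intro mult_mono card_word_prefixes) auto
    also have "\<dots> \<le> (3 * (n + 1)\<^sup>2) * (3 * (n + 1)\<^sup>2)"
      using i by (intro mult_mono power_mono) auto
    also have "\<dots> = 9 * (n + 1) ^ 4"
    proof -
      have "(n + 1) ^ 4 = (n + 1)\<^sup>2 * (n + 1)\<^sup>2" using power_add[of "n + 1" 2 2] by simp
      moreover have "3 * t * (3 * t) = 9 * (t * t)" for t :: nat by simp
      ultimately show ?thesis by (simp only:)
    qed
    finally show "card (P i) \<le> 9 * (n + 1) ^ 4" .
  qed
  also have "\<dots> = 9 * (n + 1) ^ 5" using power_add[of "Suc n" 1 4] by simp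
  finally show ?thesis .
qed


section \<open>Exponentially many words for varying orderings\<close>

text \<open>In the row \<open>y = 2\<close>, column \<open>x\<close>, the edge from the left is the smaller one iff \<open>x \<in> S\<close>. Everywhere
  else the edge from below is smaller; in particular the row \<open>y = 1\<close> carries the words \<open>a\<^sup>x b\<close>, and the
  row \<open>y = 2\<close> arises by attaching them one after the other, at the right for \<open>x \<in> S\<close> and at the left
  for \<open>x \<notin> S\<close>.\<close>
definition choice_ordering :: "nat set \<Rightarrow> ordering" where
  "choice_ordering S = (\<lambda>(x, y). y = 2 \<and> x \<in> S)"

lemma word_choice_1: "word (choice_ordering S) x 1 = replicate x letter.a @ [letter.b]"
  by (induction x) (auto simp: choice_ordering_def)

lemma word_choice_2:
  "word (choice_ordering S) (Suc n) 2 =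
     (if Suc n \<in> S then word (choice_ordering S) n 2 @ replicate (Suc n) letter.a @ [letter.b]
      else replicate (Suc n) letter.a @ letter.b # word (choice_ordering S) n 2)"
  using word_choice_1[of S "Suc n"] by (simp add: numeral_2_eq_2 choice_ordering_def)

lemma word_choice_2_start: "\<exists>k\<le>n. \<exists>r. word (choice_ordering S) n 2 = replicate k letter.a @ letter.b # r"
proof (induction n)
  case 0
  then show ?case by (auto simp: numeral_2_eq_2)
next
  case (Suc n)
  then obtain k r where k: "k \<le> n" "word (choice_ordering S) n 2 = replicate k letter.a @ letter.b # r" by blast
  show ?case
  proof (cases "Suc n \<in> S")
    case True
    then have "word (choice_ordering S) (Suc n) 2
        = replicate k letter.a @ letter.b # (r @ replicate (Suc n) letter.a @ [letter.b])"
      using k by (simp add: word_choice_2)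
    then show ?thesis using k(1) le_SucI by blast
  next
    case False
    then have "word (choice_ordering S) (Suc n) 2
        = replicate (Suc n) letter.a @ letter.b # word (choice_ordering S) n 2"
      by (simp add: word_choice_2)
    then show ?thesis by blast
  qed
qed

text \<open>The last choice is visible at the start of the word: attaching \<open>a ^ (n + 1) b\<close> at the left produces
  \<open>n + 1\<close> initial letters \<open>a\<close>, while otherwise there are at most \<open>n\<close>.\<close>
lemma word_choice_2_inj:
  "word (choice_ordering S) n 2 = word (choice_ordering T) n 2 \<Longrightarrow> S \<inter> {1..n} = T \<inter> {1..n}"
proof (induction n)
  case (Suc n)
  have nth: "word (choice_ordering S) (Suc n) 2 ! m = letter.b" if "Suc n \<in> S" "m \<le> n"
      "\<exists>r. word (choice_ordering S) n 2 = replicate m letter.a @ letter.b # r" for S m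
    using that by (auto simp: word_choice_2 nth_append)
  have key: "\<exists>m\<le>n. word (choice_ordering S) (Suc n) 2 ! m = letter.b" if "Suc n \<in> S" for S
    using word_choice_2_start[of n S] nth[OF that] by blast
  have key': "word (choice_ordering S) (Suc n) 2 ! m = letter.a" if "Suc n \<notin> S" "m \<le> n" for S m
    using that by (simp add: word_choice_2 nth_append del: replicate_Suc)
  have iff: "Suc n \<in> S \<longleftrightarrow> Suc n \<in> T"
    using key[of S] key[of T] key'[of S] key'[of T] Suc.prems by fastforce
  then have "word (choice_ordering S) n 2 = word (choice_ordering T) n 2"
    using Suc.prems by (auto simp: word_choice_2 split: if_splits)
  then have "S \<inter> {1..n} = T \<inter> {1..n}" by (rule Suc.IH)
  then show ?case using iff by (auto simp: atLeastAtMostSuc_conv)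
qed simp


section \<open>Orbits in the big subshift\<close>

lemma dense_orbit_block:
  assumes "dense_in (orbit \<omega>) big_subshift" "u \<in> language (Sigma_ord \<xi>)"
  shows "\<exists>k. block \<omega> k (length u) = u"
proof -
  obtain \<eta> k n where u: "\<eta> \<in> Sigma_ord \<xi>" "u = block \<eta> k n"
    using assms(2) unfolding language_def by blast
  have "\<eta> \<in> big_subshift" using u(1) unfolding big_subshift_def language_def by blast
  then have "\<eta> \<in> full_shift closure_of orbit \<omega>"
    using assms(1) closure_of_subtopology_subset[of full_shift big_subshift "orbit \<omega>"]
    unfolding dense_in_def by blast
  then obtain m where "block (shift_pow m \<omega>) k n = u"
    using u(2) unfolding in_closure_iff orbit_def by blast
  then show ?thesis by (auto simp: block_shift_pow)
qed

lemma block_sublist: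
  assumes "k \<le> m" "m + int l \<le> k + int n"
  shows "sublist (block \<omega> m l) (block \<omega> k n)"
proof -
  have "block \<omega> m l = take l (drop (nat (m - k)) (block \<omega> k n))"
    using assms by (intro nth_equalityI) (auto simp: block_def)
  then show ?thesis by (metis sublist_order.order.trans sublist_drop sublist_take)
qed

theorem theorem6p6:
  shows "\<not> (\<exists>\<omega>\<in>big_subshift. dense_in (orbit \<omega>) big_subshift)"
proof
  assume "\<exists>\<omega>\<in>big_subshift. dense_in (orbit \<omega>) big_subshift"
  then obtain \<omega> where \<omega>: "\<omega> \<in> big_subshift" and dense: "dense_in (orbit \<omega>) big_subshift"
    by blast
  \<comment> \<open>Any \<open>n\<close> with \<open>2 ^ n > 9 * (L + 1) ^ 5\<close> would do, where \<open>L\<close> grows like \<open>n\<^sup>2 / 2\<close>;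
    here \<open>9 * 5152 ^ 5 < 2 ^ 100\<close>.\<close>
  define n :: nat where "n = 100"
  define L where "L = (n + 2) choose n"
  define W where "W S = word (choice_ordering S) n 2" for S
  define F where "F = W ` Pow {1..n}"
  have lenW: "length (W S) = L" for S by (simp add: W_def length_word L_def)
  have "inj_on W (Pow {1..n})"
  proof (rule inj_onI)
    fix S T assume ST: "S \<in> Pow {1..n}" "T \<in> Pow {1..n}" and "W S = W T"
    then have "S \<inter> {1..n} = T \<inter> {1..n}" unfolding W_def by (intro word_choice_2_inj)
    then show "S = T" using ST by blast
  qed
  then have cardF: "card F = 2 ^ n" by (simp add: F_def card_image card_Pow)
  have "\<exists>k. block \<omega> k L = u" if uF: "u \<in> F" for u
  proof -
    obtain S where S: "u = W S" "S \<in> Pow {1..n}" using uF unfolding F_def by (rule imageE)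
    have "W S \<in> language (Sigma_ord (choice_ordering S))"
      unfolding W_def using S(2) by (intro word_in_language) (auto simp: choice_ordering_def)
    then show ?thesis using dense_orbit_block[OF dense, of "W S"] S(1) lenW by simp
  qed
  then obtain k where k: "\<And>u. u \<in> F \<Longrightarrow> block \<omega> (k u) L = u" by metis
  \<comment> \<open>One window of \<open>\<omega>\<close> contains an occurrence of every word of \<open>F\<close>, and so does the word of a
    single vertex for a single ordering.\<close>
  define M where "M = (\<Sum>u\<in>F. \<bar>k u\<bar>)"
  have M: "\<bar>k u\<bar> \<le> M" if "u \<in> F" for u
    unfolding M_def using that by (intro member_le_sum) (auto simp: F_def)
  obtain \<xi> where "block \<omega> (- M) (nat (2 * M) + L) \<in> language (Sigma_ord \<xi>)"
    using \<omega> unfolding big_subshift_def by blast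
  then obtain x y where xy: "sublist (block \<omega> (- M) (nat (2 * M) + L)) (word \<xi> x y)"
    using language_Sigma_ord_factor by blast
  have "sublist u (word \<xi> x y)" if "u \<in> F" for u
  proof -
    have "sublist (block \<omega> (k u) L) (block \<omega> (- M) (nat (2 * M) + L))"
      using M[OF that] by (intro block_sublist) auto
    then show ?thesis using xy k[OF that] sublist_order.order.trans by metis
  qed
  then have "card F \<le> 9 * (L + 1) ^ 5"
    using lenW by (intro card_factors_word[of F L \<xi>]) (auto simp: F_def)
  moreover have "L = (n + 2) * (n + 1) div 2"
    unfolding L_def using binomial_symmetric[of n "n + 2"] by (simp add: choose_two)
  ultimately show False by (simp add: cardF n_def)
qed

end
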